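(* Let $N$ be a full inverse subsemigroup of an inverse semigroup $S$ and suppose that $N$ has the kernel property. Then $\simeq_N$ is a congruence on $S$ if and only if $\mathcal{J}_N$ (restricted to $E(N)=E(S)$) is a normal congruence on $E(S)$, and in that case $\simeq_N$ is the minimal congruence on $S$ with kernel $N$.
   Context: $S$ is an inverse semigroup with semilattice of idempotents $E(S)$ and natural partial order $\leq$. An inverse subsemigroup $N$ is full if $E(N)=E(S)$, and is normal if it is full and $s^{-1}ns\in N$ for all $s\in S$, $n\in N$. A full inverse subsemigroup $N$ has the kernel property if whenever $s,t\in S$ with $st\in N$ and $n\in N$, then $snt\in N$; such an $N$ is normal. Writing $a\cdot s\cdot b$ for the product $asb$ asserts that it is a trace product: $a^{-1}a=ss^{-1}$ and $s^{-1}s=bb^{-1}$. For normal $N$, define $s\leq_N t$ iff there exist $a,b\in N$ with $a\cdot s\cdot b\leq t$, and $s\simeq_N t$ iff $s\leq_N t$ and $t\leq_N s$ (an equivalence relation). $\mathcal{J}_N$ is Green's $\mathcal{J}$-relation of the semigroup $N$. A congruence $\nu$ on $E(S)$ is normal if $e\mathrel{\nu}f$ implies $s^{-1}es\mathrel{\nu}s^{-1}fs$ for all $s\in S$. The kernel of a congruence $\rho$ on $S$ is $\{s\in S: s\mathrel{\rho}e\text{ for some }e\in E(S)\}$. *)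

theory Defs
  imports Main
begin

class inverse_semigroup = semigroup_mult +
  assumes unique_inverse: "\<exists>!y. x * y * x = x \<and> y * x * y = y"

definition sinv :: "'a::inverse_semigroup \<Rightarrow> 'a"
  where "sinv x = (THE y. x * y * x = x \<and> y * x * y = y)"

definition idems :: "'a::semigroup_mult set"
  where "idems = {e. e * e = e}"

definition nat_le :: "'a::inverse_semigroup \<Rightarrow> 'a \<Rightarrow> bool"
  where "nat_le s t \<longleftrightarrow> (\<exists>e\<in>idems. s = e * t)"

definition inverse_subsemigroup :: "'a::inverse_semigroup set \<Rightarrow> bool"
  where "inverse_subsemigroup N \<longleftrightarrow>
    (\<forall>x\<in>N. \<forall>y\<in>N. x * y \<in> N) \<and> (\<forall>x\<in>N. sinv x \<in> N)"

text \<open>The idempotents of a subsemigroup \<open>N\<close> are \<open>N \<inter> idems\<close>.\<close>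

definition full_inverse_subsemigroup :: "'a::inverse_semigroup set \<Rightarrow> bool"
  where "full_inverse_subsemigroup N \<longleftrightarrow> inverse_subsemigroup N \<and> N \<inter> idems = idems"

definition normal_inverse_subsemigroup :: "'a::inverse_semigroup set \<Rightarrow> bool"
  where "normal_inverse_subsemigroup N \<longleftrightarrow>
    full_inverse_subsemigroup N \<and> (\<forall>s. \<forall>n\<in>N. sinv s * n * s \<in> N)"

definition kernel_property :: "'a::semigroup_mult set \<Rightarrow> bool"
  where "kernel_property N \<longleftrightarrow> (\<forall>s t. s * t \<in> N \<longrightarrow> (\<forall>n\<in>N. s * n * t \<in> N))"

text \<open>
  The condition for \<open>a * s * b\<close> to be a trace product (a product in the
  inductive groupoid of the semigroup).
\<close>

definition trace_product :: "'a::inverse_semigroup \<Rightarrow> 'a \<Rightarrow> 'a \<Rightarrow> bool"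
  where "trace_product a s b \<longleftrightarrow> sinv a * a = s * sinv s \<and> sinv s * s = b * sinv b"

definition le_mod :: "'a::inverse_semigroup set \<Rightarrow> 'a \<Rightarrow> 'a \<Rightarrow> bool"
  where "le_mod N s t \<longleftrightarrow>
    (\<exists>a\<in>N. \<exists>b\<in>N. trace_product a s b \<and> nat_le (a * s * b) t)"

definition simeq_mod :: "'a::inverse_semigroup set \<Rightarrow> 'a rel"
  where "simeq_mod N = {(s, t). le_mod N s t \<and> le_mod N t s}"

text \<open>
  The principal two-sided ideal \<open>T\<^sup>1 a T\<^sup>1\<close> generated by \<open>a\<close> in the subsemigroup \<open>T\<close>,
  where \<open>T\<^sup>1\<close> is \<open>T\<close> with an identity adjoined.
\<close>

definition principal_ideal :: "'a::semigroup_mult set \<Rightarrow> 'a \<Rightarrow> 'a set"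
  where "principal_ideal T a =
    {a} \<union> {x * a | x. x \<in> T} \<union> {a * y | y. y \<in> T} \<union> {x * a * y | x y. x \<in> T \<and> y \<in> T}"

definition green_J :: "'a::semigroup_mult set \<Rightarrow> 'a rel"
  where "green_J T = {(a, b). a \<in> T \<and> b \<in> T \<and> principal_ideal T a = principal_ideal T b}"

text \<open>Congruences on the subsemigroup \<open>T\<close>; congruences on the whole semigroup are the
  case \<open>T = UNIV\<close>.\<close>

definition congruence_on :: "'a::semigroup_mult set \<Rightarrow> 'a rel \<Rightarrow> bool"
  where "congruence_on T r \<longleftrightarrow> equiv T r \<and>
    (\<forall>a b c d. (a, b) \<in> r \<longrightarrow> (c, d) \<in> r \<longrightarrow> (a * c, b * d) \<in> r)"

definition normal_congruence_on_idems :: "'a::inverse_semigroup rel \<Rightarrow> bool"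
  where "normal_congruence_on_idems r \<longleftrightarrow> congruence_on idems r \<and>
    (\<forall>e f s. (e, f) \<in> r \<longrightarrow> (sinv s * e * s, sinv s * f * s) \<in> r)"

definition congruence_kernel :: "'a::semigroup_mult rel \<Rightarrow> 'a set"
  where "congruence_kernel r = {s. \<exists>e\<in>idems. (s, e) \<in> r}"

text \<open>\<open>simeq_mod\<close> is meant for normal \<open>N\<close>; the kernel property guarantees this.\<close>

lemma sinv_cancel:
  fixes x :: "'a::inverse_semigroup"
  shows "x * sinv x * x = x" and "sinv x * x * sinv x = sinv x"
  using theI'[OF unique_inverse[of x]] unfolding sinv_def by blast+

lemma kernel_property_imp_normal:
  fixes N :: "'a::inverse_semigroup set"
  assumes "full_inverse_subsemigroup N" and "kernel_property N"
  shows "normal_inverse_subsemigroup N"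
proof -
  have "sinv s * s \<in> N" for s
  proof -
    have "sinv s * s * (sinv s * s) = sinv s * s"
      by (metis mult.assoc sinv_cancel(1))
    then show ?thesis
      using assms(1) unfolding full_inverse_subsemigroup_def idems_def by blast
  qed
  then show ?thesis
    using assms unfolding normal_inverse_subsemigroup_def kernel_property_def by blast
qed

end

(*
  For idempotents, e \<le>_N f says exactly that e lies in the ideal of N generated by f, so
  \<simeq>_N restricted to E(S) is Green's relation J_N, and if \<simeq>_N is a congruence then J_N is a
  normal congruence on E(S). The converse rests on the characterisation
    s \<simeq>_N t  iff  s^-1 s J_N t^-1 t and s t^-1 \<in> N.
  With it, the kernel property and the normality of J_N make \<simeq>_N right compatible; since
  \<simeq>_N is invariant under inversion, it is also left compatible. Finally, modulo a
  congruence with kernel N, the elements of N become idempotents, so a . s . b \<le> t collapses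
  to s \<le> t, and antisymmetry of the natural order gives minimality.
*)

theory Submission
  imports Defs
begin

section \<open>Inverse semigroups\<close>

lemma sinv_eqI:
  fixes x y :: "'a::inverse_semigroup"
  assumes "x * y * x = x" and "y * x * y = y"
  shows "sinv x = y"
  using assms unique_inverse[of x] sinv_cancel[of x] by blast

text \<open>The inverse laws with a trailing factor: once \<open>mult.assoc\<close> has bracketed a
  word to the right, these cancel in its middle.\<close>

lemma sinv_cancel_left:
  fixes x y :: "'a::inverse_semigroup"
  shows "x * (sinv x * (x * y)) = x * y" and "sinv x * (x * (sinv x * y)) = sinv x * y"
  by (metis mult.assoc sinv_cancel(1)) (metis mult.assoc sinv_cancel(2))

lemma sinv_sinv [simp]: "sinv (sinv x) = (x :: 'a::inverse_semigroup)"
  by (rule sinv_eqI) (rule sinv_cancel)+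

lemma idems_sinv [simp]: "e \<in> idems \<Longrightarrow> sinv e = (e :: 'a::inverse_semigroup)"
  by (rule sinv_eqI) (simp_all add: idems_def)

lemma sinv_mult_self_idems [simp]: "sinv x * x \<in> (idems :: 'a::inverse_semigroup set)"
  by (simp add: idems_def mult.assoc sinv_cancel_left)

lemma mult_sinv_self_idems [simp]: "x * sinv x \<in> (idems :: 'a::inverse_semigroup set)"
  by (simp add: idems_def mult.assoc sinv_cancel_left)

lemma idems_left_idem: "e \<in> idems \<Longrightarrow> e * (e * x) = e * (x :: 'a::inverse_semigroup)"
  by (simp add: idems_def flip: mult.assoc)

lemma idems_mult_closed [simp]:
  fixes e f :: "'a::inverse_semigroup"
  assumes e: "e \<in> idems" and f: "f \<in> idems"
  shows "e * f \<in> idems"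
proof -
  define x where "x = sinv (e * f)"
  have 1: "e * (f * (x * (e * f))) = e * f"
    using sinv_cancel(1)[of "e * f"] by (simp add: x_def mult.assoc)
  have 2: "x * (e * (f * x)) = x"
    using sinv_cancel(2)[of "e * f"] by (simp add: x_def mult.assoc)
  have 3: "x * (e * (f * (x * y))) = x * y" for y
    using arg_cong[OF 2, of "\<lambda>z. z * y"] by (simp add: mult.assoc)
  \<comment> \<open>With x also f x e is an inverse of e f, so the two agree by uniqueness. This
    form makes x idempotent, and then e f, the inverse of x, is x itself.\<close>
  have "x = f * x * e"
    unfolding x_def[symmetric]
    by (subst x_def, rule sinv_eqI) (simp_all add: mult.assoc e f idems_left_idem 1 3)
  then have "x * x = x"
    by (metis 3 mult.assoc)
  then have "x \<in> idems"
    by (simp add: idems_def)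
  then have "e * f = x"
    by (metis idems_sinv sinv_sinv x_def)
  with \<open>x \<in> idems\<close> show ?thesis by simp
qed

lemma idems_commute:
  fixes e f :: "'a::inverse_semigroup"
  assumes e: "e \<in> idems" and f: "f \<in> idems"
  shows "e * f = f * e"
proof -
  have ef: "e * f \<in> idems" and fe: "f * e \<in> idems" using e f by simp_all
  \<comment> \<open>Being idempotent, e f is its own inverse, so a second inverse f e must equal
    it.\<close>
  have "sinv (e * f) = f * e"
  proof (rule sinv_eqI)
    show "e * f * (f * e) * (e * f) = e * f"
      using ef by (simp add: idems_def mult.assoc idems_left_idem[OF e] idems_left_idem[OF f])
    show "f * e * (e * f) * (f * e) = f * e"
      using fe by (simp add: idems_def mult.assoc idems_left_idem[OF e] idems_left_idem[OF f])
  qed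
  with ef show ?thesis by simp
qed

lemma idems_left_commute:
  fixes e f x :: "'a::inverse_semigroup"
  assumes "e \<in> idems" and "f \<in> idems"
  shows "e * (f * x) = f * (e * x)"
  using idems_commute[OF assms] by (metis mult.assoc)

lemma sinv_mult: "sinv (x * y) = sinv y * sinv (x :: 'a::inverse_semigroup)"
proof (rule sinv_eqI)
  \<comment> \<open>The two cancellations need y y^-1 and x^-1 x to change places; they are
    commuting idempotents.\<close>
  have *: "y * (sinv y * (sinv x * (x * z))) = sinv x * (x * (y * (sinv y * z)))" for z
    using idems_left_commute[of "y * sinv y" "sinv x * x" z] by (simp add: mult.assoc)
  show "x * y * (sinv y * sinv x) * (x * y) = x * y"
    by (simp add: mult.assoc * sinv_cancel_left sinv_cancel(1)[unfolded mult.assoc])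
  have **: "sinv x * (x * (y * (sinv y * z))) = y * (sinv y * (sinv x * (x * z)))" for z
    using * by simp
  show "sinv y * sinv x * (x * y) * (sinv y * sinv x) = sinv y * sinv x"
    by (simp add: mult.assoc ** sinv_cancel_left sinv_cancel(2)[unfolded mult.assoc])
qed

lemma idems_conj [simp]:
  fixes e s :: "'a::inverse_semigroup"
  assumes "e \<in> idems"
  shows "sinv s * e * s \<in> idems"
proof -
  have "sinv s * (e * (s * (sinv s * (e * s)))) = sinv s * (e * s)"
    using idems_left_commute[OF assms mult_sinv_self_idems[of s]] idems_left_idem[OF assms]
    by (metis mult.assoc sinv_cancel(2))
  then show ?thesis by (simp add: idems_def mult.assoc)
qed

section \<open>The natural partial order\<close>

text \<open>An idempotent passes through t by conjugation: e t = t (t^-1 e t) and t e = (t e t^-1)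
  t.\<close>

lemma nat_le_iff_right:
  fixes s t :: "'a::inverse_semigroup"
  shows "nat_le s t \<longleftrightarrow> (\<exists>e\<in>idems. s = t * e)"
proof
  assume "nat_le s t"
  then obtain e where e: "e \<in> idems" and s: "s = e * t" unfolding nat_le_def by blast
  have "t * (sinv t * e * t) = t * sinv t * (e * t)" by (simp add: mult.assoc)
  also have "\<dots> = e * (t * sinv t * t)"
    using idems_left_commute[OF mult_sinv_self_idems e] by blast
  finally have "s = t * (sinv t * e * t)" by (simp add: s sinv_cancel(1))
  with e show "\<exists>e\<in>idems. s = t * e" using idems_conj by blast
next
  assume "\<exists>e\<in>idems. s = t * e"
  then obtain e where e: "e \<in> idems" and s: "s = t * e" by blast
  have "t * e * sinv t * t = t * (e * (sinv t * t))" by (simp add: mult.assoc)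
  also have "\<dots> = t * sinv t * t * e"
    using idems_commute[OF e sinv_mult_self_idems[of t]] by (simp add: mult.assoc)
  finally have "s = t * e * sinv t * t" by (simp add: s sinv_cancel(1))
  moreover have "t * e * sinv t \<in> idems"
    using idems_conj[OF e, of "sinv t"] by simp
  ultimately show "nat_le s t" unfolding nat_le_def by blast
qed

lemma nat_le_refl: "nat_le s (s :: 'a::inverse_semigroup)"
  unfolding nat_le_def by (rule bexI[of _ "s * sinv s"]) (simp_all add: sinv_cancel(1))

lemma nat_le_trans:
  fixes s t u :: "'a::inverse_semigroup"
  assumes "nat_le s t" and "nat_le t u"
  shows "nat_le s u"
  using assms unfolding nat_le_def by (metis idems_mult_closed mult.assoc)

lemma nat_le_mult_left:
  fixes s t u :: "'a::inverse_semigroup"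
  shows "nat_le s t \<Longrightarrow> nat_le (u * s) (u * t)"
  unfolding nat_le_iff_right by (metis mult.assoc)

lemma nat_le_mult_right:
  fixes s t u :: "'a::inverse_semigroup"
  shows "nat_le s t \<Longrightarrow> nat_le (s * u) (t * u)"
  unfolding nat_le_def by (metis mult.assoc)

lemma nat_le_sinv:
  fixes s t :: "'a::inverse_semigroup"
  assumes "nat_le s t"
  shows "nat_le (sinv s) (sinv t)"
proof -
  obtain e where "e \<in> idems" "s = e * t" using assms unfolding nat_le_def by blast
  then have "sinv s = sinv t * e" by (simp add: sinv_mult)
  with \<open>e \<in> idems\<close> show ?thesis unfolding nat_le_iff_right by blast
qed

section \<open>Congruences and inversion\<close>

lemma congruence_sinv:
  fixes \<rho> :: "'a::inverse_semigroup rel"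
  assumes \<rho>: "congruence_on UNIV \<rho>" and st: "(s, t) \<in> \<rho>"
  shows "(sinv s, sinv t) \<in> \<rho>"
proof -
  have mult: "(a * c, b * d) \<in> \<rho>" if "(a, b) \<in> \<rho>" "(c, d) \<in> \<rho>" for a b c d
    using \<rho> that unfolding congruence_on_def by blast
  have refl: "(x, x) \<in> \<rho>" for x
    using \<rho> unfolding congruence_on_def equiv_def refl_on_def by blast
  have sym: "(y, x) \<in> \<rho>" if "(x, y) \<in> \<rho>" for x y
    using \<rho> that unfolding congruence_on_def equiv_def sym_def by blast
  have trans [trans]: "(x, z) \<in> \<rho>" if "(x, y) \<in> \<rho>" "(y, z) \<in> \<rho>" for x y z
    using \<rho> that unfolding congruence_on_def equiv_def trans_def by blast
  \<comment> \<open>Exchanging x and y one factor at a time leads from x^-1 to x^-1 y y^-1 x x^-1.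
    Here y y^-1 and x x^-1 commute and x x^-1 is absorbed, so x^-1 y y^-1 remains.\<close>
  have half: "(sinv x, sinv x * x * sinv y) \<in> \<rho>" if xy: "(x, y) \<in> \<rho>" for x y
  proof -
    have "(sinv x * x * sinv x, sinv x * y * sinv x) \<in> \<rho>"
      by (intro mult refl xy)
    then have "(sinv x, sinv x * y * sinv y * (y * sinv x)) \<in> \<rho>"
      by (simp add: mult.assoc sinv_cancel_left sinv_cancel(2)[unfolded mult.assoc])
    also have "(sinv x * y * sinv y * (y * sinv x), sinv x * x * sinv y * (x * sinv x)) \<in> \<rho>"
      by (intro mult refl sym[OF xy])
    also have "sinv x * x * sinv y * (x * sinv x) = sinv x * (x * sinv y * (x * sinv x))"
      by (simp add: mult.assoc)
    also have "(sinv x * (x * sinv y * (x * sinv x)), sinv x * (y * sinv y * (x * sinv x))) \<in> \<rho>"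
      by (intro mult refl xy)
    also have "y * sinv y * (x * sinv x) = x * sinv x * (y * sinv y)"
      by (rule idems_commute) simp_all
    also have "sinv x * (x * sinv x * (y * sinv y)) = sinv x * y * sinv y"
      by (simp add: mult.assoc sinv_cancel_left)
    also have "(sinv x * y * sinv y, sinv x * x * sinv y) \<in> \<rho>"
      by (intro mult refl sym[OF xy])
    finally show ?thesis .
  qed
  \<comment> \<open>Applying \<open>half\<close> in both directions and commuting s^-1 s with t^-1 t
    links s^-1 to t^-1.\<close>
  have "(sinv s, sinv s * s * sinv t) \<in> \<rho>" by (rule half[OF st])
  also have "(sinv s * s * sinv t, sinv s * s * (sinv t * t * sinv s)) \<in> \<rho>"
    by (intro mult refl half sym[OF st])
  also have "sinv s * s * (sinv t * t * sinv s) = sinv t * t * sinv s"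
    using idems_left_commute[of "sinv s * s" "sinv t * t" "sinv s"]
    by (simp add: mult.assoc sinv_cancel_left sinv_cancel(2)[unfolded mult.assoc])
  also have "(sinv t * t * sinv s, sinv t) \<in> \<rho>"
    by (rule sym[OF half[OF sym[OF st]]])
  finally show ?thesis .
qed

section \<open>The preorder modulo a full inverse subsemigroup\<close>

context
  fixes N :: "'a::inverse_semigroup set"
  assumes full: "full_inverse_subsemigroup N"
begin

lemma full_mult_closed: "x \<in> N \<Longrightarrow> y \<in> N \<Longrightarrow> x * y \<in> N"
  using full by (simp add: full_inverse_subsemigroup_def inverse_subsemigroup_def)

lemma full_sinv_closed: "x \<in> N \<Longrightarrow> sinv x \<in> N"
  using full by (simp add: full_inverse_subsemigroup_def inverse_subsemigroup_def)

lemma full_idems: "e \<in> idems \<Longrightarrow> e \<in> N"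
  using full unfolding full_inverse_subsemigroup_def by blast

text \<open>The second trace condition is turned round so that rewriting replaces both products of
  witnesses by idempotents of s.\<close>

lemma le_modE:
  assumes "le_mod N s t"
  obtains a b where "a \<in> N" "b \<in> N" "sinv a * a = s * sinv s" "b * sinv b = sinv s * s"
    "nat_le (a * s * b) t"
  using assms unfolding le_mod_def trace_product_def by metis

lemma le_modI:
  assumes "a \<in> N" "b \<in> N" "sinv a * a = s * sinv s" "b * sinv b = sinv s * s"
    "nat_le (a * s * b) t"
  shows "le_mod N s t"
  using assms unfolding le_mod_def trace_product_def by metis

lemma le_mod_refl: "le_mod N s s"
  by (rule le_modI[of "s * sinv s" "sinv s * s"])
    (simp_all add: full_idems, simp_all add: mult.assoc sinv_cancel_left nat_le_refl
      sinv_cancel(1)[unfolded mult.assoc])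

lemma le_mod_sinv:
  assumes "le_mod N s t"
  shows "le_mod N (sinv s) (sinv t)"
proof -
  obtain a b where "a \<in> N" "b \<in> N" "sinv a * a = s * sinv s" "b * sinv b = sinv s * s"
    "nat_le (a * s * b) t"
    using assms by (rule le_modE)
  then show ?thesis
    by (intro le_modI[of "sinv b" "sinv a"])
      (auto simp: full_sinv_closed sinv_mult mult.assoc dest: nat_le_sinv)
qed

text \<open>The witnesses multiply to c a and b d, since c (a s b) d \<le> c t d \<le> u. The work
  lies in showing that the new product is again a trace product.\<close>

lemma le_mod_trans:
  assumes "le_mod N s t" and "le_mod N t u"
  shows "le_mod N s u"
proof -
  obtain a b where ab: "a \<in> N" "b \<in> N" "sinv a * a = s * sinv s" "b * sinv b = sinv s * s"
    and x: "nat_le (a * s * b) t"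
    using assms(1) by (rule le_modE)
  obtain c d where cd: "c \<in> N" "d \<in> N" "sinv c * c = t * sinv t" "d * sinv d = sinv t * t"
    and y: "nat_le (c * t * d) u"
    using assms(2) by (rule le_modE)
  define x where "x = a * s * b"
  have xx: "x * sinv x = a * sinv a"
  proof -
    have "x * sinv x = a * (s * (b * sinv b) * sinv s) * sinv a"
      by (simp add: x_def sinv_mult mult.assoc)
    also have "\<dots> = a * (sinv a * a) * sinv a"
      by (simp add: ab(3,4) mult.assoc sinv_cancel_left)
    finally show ?thesis by (simp add: mult.assoc sinv_cancel(2) sinv_cancel_left)
  qed
  have xx': "sinv x * x = sinv b * b"
  proof -
    have "sinv x * x = sinv b * (sinv s * (sinv a * a) * s) * b"
      by (simp add: x_def sinv_mult mult.assoc)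
    also have "\<dots> = sinv b * (b * sinv b) * b"
      by (simp add: ab(3,4) mult.assoc sinv_cancel_left)
    finally show ?thesis by (simp add: mult.assoc sinv_cancel(1) sinv_cancel_left)
  qed
  obtain e where e: "x = e * t" using x unfolding x_def nat_le_def by blast
  obtain f where f: "x = t * f" using x unfolding x_def nat_le_iff_right by blast
  \<comment> \<open>As x lies below t, a a^-1 = x x^-1 lies below t t^-1 = c^-1 c, and b^-1 b = x^-1
    x lies below t^-1 t = d d^-1. Hence c^-1 c and d d^-1 are absorbed by a and b.\<close>
  have tx: "t * sinv t * x = x"
    by (simp add: f mult.assoc sinv_cancel_left)
  have xt: "x * (sinv t * t) = x"
    by (simp add: e mult.assoc sinv_cancel(1)[unfolded mult.assoc])
  show ?thesis
  proof (rule le_modI)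
    show "c * a \<in> N" "b * d \<in> N" using ab cd by (simp_all add: full_mult_closed)
    have "a * sinv a = t * sinv t * (a * sinv a)"
      using tx xx by (metis mult.assoc)
    then have "sinv c * c * a = a"
      by (metis cd(3) mult.assoc sinv_cancel(1))
    then show "sinv (c * a) * (c * a) = s * sinv s"
      by (simp add: sinv_mult mult.assoc ab(3))
    have "sinv b * b = sinv b * b * (sinv t * t)"
      using xt xx' by (metis mult.assoc)
    then have "b * (d * sinv d) = b"
      by (metis cd(4) mult.assoc sinv_cancel(1))
    then have "b * d * (sinv d * sinv b) = b * sinv b"
      by (metis mult.assoc)
    then show "b * d * sinv (b * d) = sinv s * s"
      by (simp add: sinv_mult ab(4))
    have "nat_le (c * x * d) (c * t * d)"
      by (intro nat_le_mult_left nat_le_mult_right) (simp add: x x_def)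
    then show "nat_le (c * a * s * (b * d)) u"
      using nat_le_trans[OF _ y] by (simp add: x_def mult.assoc)
  qed
qed

lemma equiv_simeq_mod: "equiv UNIV (simeq_mod N)"
  by (rule equivI)
    (auto simp: simeq_mod_def refl_on_def sym_def trans_def le_mod_refl intro: le_mod_trans)

section \<open>Principal ideals of idempotents and Green's J-relation\<close>

text \<open>Since e = e e e with e in N, the one-sided summands of the ideal are absorbed by the
  two-sided one.\<close>

lemma principal_ideal_idem:
  assumes "e \<in> idems"
  shows "principal_ideal N e = {x * e * y | x y. x \<in> N \<and> y \<in> N}" (is "_ = ?R")
proof
  have e: "e \<in> N" "e * e = e" using assms full_idems by (auto simp: idems_def)
  have "e = e * e * e" "x * e = x * e * e" "e * x = e * e * x" for x
    using e by (simp_all add: mult.assoc)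
  then show "principal_ideal N e \<subseteq> ?R"
    unfolding principal_ideal_def using e(1) by blast
qed (auto simp: principal_ideal_def)

text \<open>The element n is an arrow of the inductive groupoid of N between e and an idempotent n
  n^-1 below f. It later supplies the witnesses for \<open>le_mod\<close>.\<close>

lemma mem_principal_ideal_idem_iff:
  assumes e: "e \<in> idems" and f: "f \<in> idems"
  shows "e \<in> principal_ideal N f \<longleftrightarrow> (\<exists>n\<in>N. sinv n * n = e \<and> f * n = n)"
proof
  assume "e \<in> principal_ideal N f"
  then obtain x y where xy: "x \<in> N" "y \<in> N" "e = x * f * y"
    by (auto simp: principal_ideal_idem[OF f])
  have ee: "e * e = e" and ff: "f * f = f" using e f by (auto simp: idems_def)
  \<comment> \<open>Cutting y down to f on the left and e on the right gives x n = e and n e = n,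
    which force n^-1 n = e.\<close>
  define n where "n = f * y * e"
  have "n \<in> N" using xy e f by (simp add: n_def full_idems full_mult_closed)
  have xn: "e = x * n" using ee xy(3) by (simp add: n_def mult.assoc)
  have ne: "n * e = n" using ee by (simp add: n_def mult.assoc)
  have "sinv n * n = sinv n * n * e" using ne by (simp add: mult.assoc)
  also have "\<dots> = e * (sinv n * n)" by (rule idems_commute) (simp_all add: e)
  also have "\<dots> = x * (n * sinv n * n)" by (simp add: xn mult.assoc)
  also have "\<dots> = e" by (simp add: sinv_cancel(1) xn)
  finally have "sinv n * n = e" .
  moreover have "f * n = n" using ff by (simp add: n_def flip: mult.assoc)
  ultimately show "\<exists>n\<in>N. sinv n * n = e \<and> f * n = n" using \<open>n \<in> N\<close> by blast
next
  assume "\<exists>n\<in>N. sinv n * n = e \<and> f * n = n"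
  then obtain n where n: "n \<in> N" "sinv n * n = e" "f * n = n" by blast
  then have "e = sinv n * f * n" by (simp add: mult.assoc)
  with n(1) show "e \<in> principal_ideal N f"
    unfolding principal_ideal_def using full_sinv_closed by blast
qed

lemma green_J_idems_iff:
  assumes e: "e \<in> idems" and f: "f \<in> idems"
  shows "(e, f) \<in> green_J N \<longleftrightarrow> e \<in> principal_ideal N f \<and> f \<in> principal_ideal N e"
proof -
  have sub: "principal_ideal N g \<subseteq> principal_ideal N h"
    if gh: "g \<in> principal_ideal N h" "g \<in> idems" "h \<in> idems" for g h
  proof -
    obtain x y where "x \<in> N" "y \<in> N" and g: "g = x * h * y"
      using gh by (auto simp: principal_ideal_idem)
    then have "u * g * v = (u * x) * h * (y * v) \<and> u * x \<in> N \<and> y * v \<in> N"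
      if "u \<in> N" "v \<in> N" for u v
      using that by (simp add: g mult.assoc full_mult_closed)
    then show ?thesis using gh(2,3) by (fastforce simp: principal_ideal_idem)
  qed
  have "g \<in> principal_ideal N g" for g
    by (simp add: principal_ideal_def)
  then show ?thesis
    using sub e f full_idems by (auto simp: green_J_def)
qed

lemma le_mod_idems_iff:
  assumes e: "e \<in> idems" and f: "f \<in> idems"
  shows "le_mod N e f \<longleftrightarrow> e \<in> principal_ideal N f"
proof
  have ee: "e * e = e" and ff: "f * f = f" using e f by (auto simp: idems_def)
  {
    assume "le_mod N e f"
    then obtain a b where ab: "a \<in> N" "b \<in> N" "sinv a * a = e" "b * sinv b = e"
      and le: "nat_le (a * e * b) f"
      by (rule le_modE) (simp add: e ee)
    obtain g where g: "g \<in> idems" "a * e * b = f * g"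
      using le unfolding nat_le_iff_right by blast
    \<comment> \<open>The trace conditions make multiplication by a and b reversible, so e is
      recovered from a e b = f g.\<close>
    have "e = sinv a * a * e * (b * sinv b)" by (simp add: ab(3,4) ee)
    also have "\<dots> = sinv a * (a * e * b) * sinv b" by (simp add: mult.assoc)
    also have "\<dots> = sinv a * f * (g * sinv b)" unfolding g(2) by (simp add: mult.assoc)
    finally show "e \<in> principal_ideal N f"
      unfolding principal_ideal_def
      using ab(1,2) g(1) full_idems full_mult_closed full_sinv_closed by blast
  next
    assume "e \<in> principal_ideal N f"
    then obtain n where n: "n \<in> N" "sinv n * n = e" "f * n = n"
      using mem_principal_ideal_idem_iff[OF e f] by blast
    have "n * e * sinv n = f * n * (sinv n * n) * sinv n" by (simp only: n(2,3))
    also have "\<dots> = f * (n * sinv n)" by (simp add: mult.assoc sinv_cancel_left)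
    finally have "nat_le (n * e * sinv n) f"
      unfolding nat_le_iff_right using mult_sinv_self_idems by blast
    with n show "le_mod N e f"
      by (intro le_modI[of n "sinv n"]) (simp_all add: full_sinv_closed e ee)
  }
qed

text \<open>This bridge carries the equivalence and compatibility properties of
  \<open>simeq_mod\<close> over to \<open>green_J\<close>; conjugation by s is compatible because s
  is related to itself.\<close>

lemma simeq_mod_idems: "simeq_mod N \<inter> (idems \<times> idems) = green_J N \<inter> (idems \<times> idems)"
  by (auto simp: simeq_mod_def le_mod_idems_iff green_J_idems_iff)

lemma normal_congruence_green_J:
  assumes "congruence_on UNIV (simeq_mod N)"
  shows "normal_congruence_on_idems (green_J N \<inter> (idems \<times> idems))"
proof -
  have refl: "(s, s) \<in> simeq_mod N" for s
    by (simp add: simeq_mod_def le_mod_refl)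
  have mult: "(a * c, b * d) \<in> simeq_mod N" if "(a, b) \<in> simeq_mod N" "(c, d) \<in> simeq_mod N" for a b c d
    using assms that unfolding congruence_on_def by blast
  have "equiv idems (simeq_mod N \<inter> (idems \<times> idems))"
    using equiv_simeq_mod unfolding equiv_def refl_on_def sym_def trans_def by blast
  then show ?thesis
    unfolding normal_congruence_on_idems_def congruence_on_def simeq_mod_idems[symmetric]
    by (auto intro: mult refl)
qed

section \<open>The kernel and minimality\<close>

lemma kernel_simeq_mod: "congruence_kernel (simeq_mod N) = N"
proof
  show "congruence_kernel (simeq_mod N) \<subseteq> N"
  proof
    fix s assume "s \<in> congruence_kernel (simeq_mod N)"
    then obtain e where e: "e \<in> idems" "le_mod N s e"
      unfolding congruence_kernel_def simeq_mod_def by blast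
    from e(2) obtain a b where ab: "a \<in> N" "b \<in> N" "sinv a * a = s * sinv s" "b * sinv b = sinv s * s"
      and le: "nat_le (a * s * b) e"
      by (rule le_modE)
    \<comment> \<open>An element below an idempotent is idempotent, hence in N; undoing a and b then
      puts s itself in N.\<close>
    have x: "a * s * b \<in> N" using le e(1) full_idems by (auto simp: nat_le_def)
    have "s = (sinv a * a) * s * (b * sinv b)"
      by (simp add: ab(3,4) mult.assoc sinv_cancel_left sinv_cancel(1)[unfolded mult.assoc])
    also have "\<dots> = sinv a * (a * s * b) * sinv b" by (simp add: mult.assoc)
    finally show "s \<in> N"
      using x ab(1,2) full_mult_closed full_sinv_closed by metis
  qed
  show "N \<subseteq> congruence_kernel (simeq_mod N)"
  proof
    fix n assume n: "n \<in> N"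
    have idem: "sinv n * n * (sinv n * n) = sinv n * n"
      by (simp add: mult.assoc sinv_cancel_left)
    have "le_mod N n (sinv n * n)"
      by (rule le_modI[of "sinv n" "sinv n * n"])
        (simp_all add: n full_sinv_closed full_idems idem nat_le_refl)
    moreover have "le_mod N (sinv n * n) n"
      by (rule le_modI[of n "sinv n * n"])
        (simp_all add: n full_idems idem, simp add: mult.assoc sinv_cancel_left nat_le_refl
          sinv_cancel(1)[unfolded mult.assoc])
    ultimately show "n \<in> congruence_kernel (simeq_mod N)"
      unfolding congruence_kernel_def simeq_mod_def using sinv_mult_self_idems by blast
  qed
qed

lemma simeq_mod_minimal:
  assumes \<rho>: "congruence_on UNIV \<rho>" and ker: "congruence_kernel \<rho> = N"
  shows "simeq_mod N \<subseteq> \<rho>"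
proof -
  have mult: "(a * c, b * d) \<in> \<rho>" if "(a, b) \<in> \<rho>" "(c, d) \<in> \<rho>" for a b c d
    using \<rho> that unfolding congruence_on_def by blast
  have refl: "(x, x) \<in> \<rho>" for x
    using \<rho> unfolding congruence_on_def equiv_def refl_on_def by blast
  have sym: "(y, x) \<in> \<rho>" if "(x, y) \<in> \<rho>" for x y
    using \<rho> that unfolding congruence_on_def equiv_def sym_def by blast
  have trans [trans]: "(x, z) \<in> \<rho>" if "(x, y) \<in> \<rho>" "(y, z) \<in> \<rho>" for x y z
    using \<rho> that unfolding congruence_on_def equiv_def trans_def by blast
  \<comment> \<open>If n is related to an idempotent e, so is n^-1, and therefore both n^-1 n and n
    n^-1 are related to e e = e.\<close>
  have collapse: "(n, sinv n * n) \<in> \<rho> \<and> (n, n * sinv n) \<in> \<rho>" if n: "n \<in> N" for n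
  proof -
    obtain e where e: "e \<in> idems" "(n, e) \<in> \<rho>"
      using n ker unfolding congruence_kernel_def by blast
    have "(sinv n, e) \<in> \<rho>"
      using congruence_sinv[OF \<rho> e(2)] e(1) by simp
    moreover have "e * e = e" using e(1) by (simp add: idems_def)
    ultimately have "(sinv n * n, e) \<in> \<rho>" "(n * sinv n, e) \<in> \<rho>"
      using mult e(2) by metis+
    then show ?thesis using trans sym e(2) by blast
  qed
  have le: "\<exists>e\<in>idems. (s, e * t) \<in> \<rho>" if "le_mod N s t" for s t
  proof -
    from that obtain a b where ab: "a \<in> N" "b \<in> N" "sinv a * a = s * sinv s" "b * sinv b = sinv s * s"
      and le: "nat_le (a * s * b) t"
      by (rule le_modE)
    \<comment> \<open>Modulo \<rho>, a may be replaced by a^-1 a = s s^-1 and b by b b^-1 = s^-1 s,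
      and s absorbs both.\<close>
    have "(a * s * b, sinv a * a * s * (b * sinv b)) \<in> \<rho>"
      by (intro mult refl) (simp_all add: collapse ab(1,2))
    also have "sinv a * a * s * (b * sinv b) = s"
      by (simp add: ab(3,4) mult.assoc sinv_cancel_left sinv_cancel(1)[unfolded mult.assoc])
    finally have "(s, a * s * b) \<in> \<rho>" by (rule sym)
    with le show ?thesis by (auto simp: nat_le_def)
  qed
  have "(s, t) \<in> \<rho>" if st: "(s, t) \<in> simeq_mod N" for s t
  proof -
    obtain e f where e: "e \<in> idems" "(s, e * t) \<in> \<rho>" and f: "f \<in> idems" "(t, f * s) \<in> \<rho>"
      using st le unfolding simeq_mod_def by blast
    \<comment> \<open>Antisymmetry of the natural order, carried out on representatives: s ~ e t ~ e
      f s ~ e f e t = f e t ~ f s ~ t.\<close>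
    note e(2)
    also have "(e * t, e * (f * s)) \<in> \<rho>" by (intro mult refl f)
    also have "(e * (f * s), e * (f * (e * t))) \<in> \<rho>" by (intro mult refl e)
    also have "e * (f * (e * t)) = f * (e * t)"
      using e(1) f(1) by (metis idems_left_commute idems_left_idem)
    also have "(f * (e * t), f * s) \<in> \<rho>" by (intro mult refl sym[OF e(2)])
    also have "(f * s, t) \<in> \<rho>" by (rule sym[OF f(2)])
    finally show ?thesis .
  qed
  then show ?thesis by auto
qed

section \<open>The kernel property\<close>

text \<open>The trace witnesses are traded for two conditions that behave well under right
  multiplication: one is handled by normality of \<open>green_J\<close>, the other by the kernel
  property.\<close>

lemma simeq_mod_iff:
  assumes ker: "kernel_property N"
  shows "(s, t) \<in> simeq_mod N \<longleftrightarrow> (sinv s * s, sinv t * t) \<in> green_J N \<and> s * sinv t \<in> N"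
proof
  have mem: "sinv x * x \<in> principal_ideal N (sinv y * y)" if "le_mod N x y" for x y
  proof -
    from that obtain a b where ab: "a \<in> N" "b \<in> N" "sinv a * a = x * sinv x" "b * sinv b = sinv x * x"
      and le: "nat_le (a * x * b) y"
      by (rule le_modE)
    obtain e where e: "e \<in> idems" "a * x * b = e * y"
      using le by (auto simp: nat_le_def)
    \<comment> \<open>Solving for b through a x b = e y shows that b ends in y, so y^-1 y fixes it
      on the right. Then x^-1 x = b (y^-1 y) b^-1 lies in the ideal.\<close>
    have "b = b * sinv b * b" by (simp add: sinv_cancel(1))
    also have "\<dots> = sinv x * (sinv a * a) * x * b"
      by (simp add: ab(3,4) mult.assoc sinv_cancel_left)
    also have "\<dots> = sinv x * sinv a * (a * x * b)" by (simp add: mult.assoc)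
    also have "\<dots> = sinv x * sinv a * e * y" unfolding e(2) by (simp add: mult.assoc)
    finally have "b = sinv x * sinv a * e * y" .
    then have "b * (sinv y * y) = b"
      by (metis mult.assoc sinv_cancel(1))
    then have "sinv x * x = b * (sinv y * y) * sinv b" by (simp add: ab(4))
    then show ?thesis
      unfolding principal_ideal_def using ab(2) full_sinv_closed by blast
  qed
  assume st: "(s, t) \<in> simeq_mod N"
  then have le: "le_mod N s t" "le_mod N t s" by (auto simp: simeq_mod_def)
  from le(2) obtain c d where cd: "c \<in> N" "d \<in> N" "sinv c * c = t * sinv t" "d * sinv d = sinv t * t"
    and ctd: "nat_le (c * t * d) s"
    by (rule le_modE)
  define g where "g = sinv (c * t * d) * (c * t * d)"
  have g: "g = sinv d * d"
  proof -
    have "g = sinv d * (sinv t * (sinv c * c) * t) * d"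
      by (simp add: g_def sinv_mult mult.assoc)
    also have "\<dots> = sinv d * (d * sinv d) * d"
      by (simp add: cd(3,4) mult.assoc sinv_cancel_left)
    finally show ?thesis by (simp add: mult.assoc sinv_cancel_left)
  qed
  obtain h where h: "h \<in> idems" "c * t * d = s * h"
    using ctd by (auto simp: nat_le_iff_right)
  have "sinv c * c * t * (d * sinv d) = sinv c * (s * h) * sinv d"
    using h(2) by (metis mult.assoc)
  then have t: "t = sinv c * s * (h * sinv d)"
    by (simp add: cd(3,4) mult.assoc sinv_cancel_left sinv_cancel(1)[unfolded mult.assoc])
  \<comment> \<open>From t = c^-1 s h d^-1 follows s t^-1 = s (d h) s^-1 c. The kernel property
    inserts d h into s s^-1, which lies in N.\<close>
  have "s * (d * h) * sinv s \<in> N"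
    using ker full_idems[OF mult_sinv_self_idems[of s]] full_mult_closed[OF cd(2) full_idems[OF h(1)]]
    unfolding kernel_property_def by blast
  then have "s * (d * h) * sinv s * c \<in> N"
    using cd(1) by (rule full_mult_closed)
  moreover have "s * sinv t = s * (d * h) * sinv s * c"
    by (subst t) (simp add: sinv_mult h(1) mult.assoc)
  ultimately show "(sinv s * s, sinv t * t) \<in> green_J N \<and> s * sinv t \<in> N"
    using mem le by (simp add: green_J_idems_iff)
next
  have le: "le_mod N x y"
    if J: "sinv x * x \<in> principal_ideal N (sinv y * y)" and xy: "x * sinv y \<in> N" for x y
  proof -
    obtain n where n: "n \<in> N" "sinv n * n = sinv x * x" "sinv y * y * n = n"
      using J mem_principal_ideal_idem_iff by (metis sinv_mult_self_idems)
    \<comment> \<open>Inserting n^-1 into x y^-1 and inverting gives the left witness a = y n x^-1;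
      with b = n^-1 the product a x b becomes y n n^-1, which is below y.\<close>
    have "x * sinv n * sinv y \<in> N"
      using ker xy full_sinv_closed[OF n(1)] unfolding kernel_property_def by blast
    from full_sinv_closed[OF this] have a: "y * n * sinv x \<in> N"
      by (simp add: sinv_mult mult.assoc)
    show ?thesis
    proof (rule le_modI[OF a full_sinv_closed[OF n(1)]])
      have "sinv (y * n * sinv x) * (y * n * sinv x) = x * (sinv n * (sinv y * y * n)) * sinv x"
        by (simp add: sinv_mult mult.assoc)
      also have "\<dots> = x * sinv x"
        by (simp add: n(2,3)) (simp add: mult.assoc sinv_cancel_left)
      finally show "sinv (y * n * sinv x) * (y * n * sinv x) = x * sinv x" .
      show "sinv n * sinv (sinv n) = sinv x * x" by (simp add: n(2))
      have "y * n * sinv x * x * sinv n = y * (n * (sinv n * n) * sinv n)"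
        by (simp add: n(2) mult.assoc)
      also have "\<dots> = y * (n * sinv n)"
        by (simp add: mult.assoc sinv_cancel_left)
      finally show "nat_le (y * n * sinv x * x * sinv n) y"
        unfolding nat_le_iff_right using mult_sinv_self_idems by blast
    qed
  qed
  assume *: "(sinv s * s, sinv t * t) \<in> green_J N \<and> s * sinv t \<in> N"
  then have "t * sinv s \<in> N"
    using full_sinv_closed[of "s * sinv t"] by (simp add: sinv_mult)
  with * show "(s, t) \<in> simeq_mod N"
    unfolding simeq_mod_def by (auto simp: green_J_idems_iff intro: le)
qed

lemma congruence_simeq_mod:
  assumes ker: "kernel_property N"
    and normal: "normal_congruence_on_idems (green_J N \<inter> (idems \<times> idems))"
  shows "congruence_on UNIV (simeq_mod N)"
proof -
  have right: "(s * u, t * u) \<in> simeq_mod N" if "(s, t) \<in> simeq_mod N" for s t u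
  proof -
    have st: "(sinv s * s, sinv t * t) \<in> green_J N" "s * sinv t \<in> N"
      using that by (auto simp: simeq_mod_iff[OF ker])
    \<comment> \<open>This element is (s u) (t u)^-1, and the conjugates by u in the next claim are
      (s u)^-1 (s u) and (t u)^-1 (t u).\<close>
    have "s * (u * sinv u) * sinv t \<in> N"
      using ker st(2) full_idems[OF mult_sinv_self_idems[of u]]
      unfolding kernel_property_def by blast
    moreover have "(sinv u * (sinv s * s) * u, sinv u * (sinv t * t) * u) \<in> green_J N"
      using normal st(1) sinv_mult_self_idems unfolding normal_congruence_on_idems_def by blast
    ultimately show ?thesis
      by (simp add: simeq_mod_iff[OF ker] sinv_mult mult.assoc)
  qed
  have inv: "(sinv s, sinv t) \<in> simeq_mod N" if "(s, t) \<in> simeq_mod N" for s t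
    using that by (simp add: simeq_mod_def le_mod_sinv)
  \<comment> \<open>Inversion reverses products, so right compatibility with u^-1 becomes left
    compatibility with u.\<close>
  have left: "(u * s, u * t) \<in> simeq_mod N" if "(s, t) \<in> simeq_mod N" for s t u
    using inv[OF right[OF inv[OF that], of "sinv u"]] by (simp add: sinv_mult)
  show ?thesis
    unfolding congruence_on_def
    using equiv_simeq_mod left right unfolding equiv_def trans_def by blast
qed

end

theorem theorem3p5:
  fixes N :: "'a::inverse_semigroup set"
  assumes "full_inverse_subsemigroup N"
    and "kernel_property N"
  shows "(congruence_on UNIV (simeq_mod N) \<longleftrightarrow>
           normal_congruence_on_idems (green_J N \<inter> (idems \<times> idems)))
       \<and> (congruence_on UNIV (simeq_mod N) \<longrightarrow>
           congruence_kernel (simeq_mod N) = N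
           \<and> (\<forall>\<rho>. congruence_on UNIV \<rho> \<and> congruence_kernel \<rho> = N \<longrightarrow> simeq_mod N \<subseteq> \<rho>))"
  using normal_congruence_green_J[OF assms(1)] congruence_simeq_mod[OF assms]
    kernel_simeq_mod[OF assms(1)] simeq_mod_minimal[OF assms(1)]
  by blast

end
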